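(* Let $\mathcal{S}=\langle\mathcal{L},\vdash\rangle$ be a monotonic logic with $\mathcal{L}$ infinite. If $\mathcal{S}$ is finitely trivializable, then sECQ holds in $\mathcal{S}$.
   Context: A logic is a pair $\langle\mathcal{L},\vdash\rangle$ with $\mathcal{L}$ a set and $\vdash\,\subseteq\mathcal{P}(\mathcal{L})\times\mathcal{L}$; $C_\vdash(\Gamma)=\{\alpha:\Gamma\vdash\alpha\}$. Monotonic: $\Gamma\subseteq\Sigma$ implies $C_\vdash(\Gamma)\subseteq C_\vdash(\Sigma)$. $\mathcal{S}$ is finitely trivializable if there is a finite $\Gamma\subseteq\mathcal{L}$ with $C_\vdash(\Gamma)=\mathcal{L}$. sECQ: for each $\alpha\in\mathcal{L}$ there is $\Gamma\subsetneq\mathcal{L}$ with $\alpha\in\Gamma$ and $C_\vdash(\Gamma)=\mathcal{L}$. *)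

theory Defs
  imports Main
begin

text \<open>A logic is given by its carrier \<open>L\<close> and its consequence relation \<open>V\<close>, a set of
  pairs of a set of formulas and a formula. No structure on formulas is assumed.\<close>

definition is_logic :: "'a set \<Rightarrow> ('a set \<times> 'a) set \<Rightarrow> bool" where
  "is_logic L V \<longleftrightarrow> V \<subseteq> Pow L \<times> L"

definition Cn :: "('a set \<times> 'a) set \<Rightarrow> 'a set \<Rightarrow> 'a set" where
  "Cn V \<Gamma> = {\<alpha>. (\<Gamma>, \<alpha>) \<in> V}"

definition monotonic :: "'a set \<Rightarrow> ('a set \<times> 'a) set \<Rightarrow> bool" where
  "monotonic L V \<longleftrightarrow> (\<forall>\<Gamma> \<Sigma>. \<Gamma> \<subseteq> L \<longrightarrow> \<Sigma> \<subseteq> L \<longrightarrow> \<Gamma> \<subseteq> \<Sigma> \<longrightarrow> Cn V \<Gamma> \<subseteq> Cn V \<Sigma>)"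

definition finitely_trivializable :: "'a set \<Rightarrow> ('a set \<times> 'a) set \<Rightarrow> bool" where
  "finitely_trivializable L V \<longleftrightarrow> (\<exists>\<Gamma>. \<Gamma> \<subseteq> L \<and> finite \<Gamma> \<and> Cn V \<Gamma> = L)"

definition sECQ :: "'a set \<Rightarrow> ('a set \<times> 'a) set \<Rightarrow> bool" where
  "sECQ L V \<longleftrightarrow> (\<forall>\<alpha>\<in>L. \<exists>\<Gamma>. \<Gamma> \<subset> L \<and> \<alpha> \<in> \<Gamma> \<and> Cn V \<Gamma> = L)"

end

theory Submission
  imports Defs
begin

lemma Cn_subset_carrier:
  assumes "is_logic L V"
  shows "Cn V \<Gamma> \<subseteq> L"
  using assms unfolding is_logic_def Cn_def by blast

lemma Cn_mono:
  assumes "monotonic L V" and "\<Gamma> \<subseteq> \<Sigma>" and "\<Sigma> \<subseteq> L"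
  shows "Cn V \<Gamma> \<subseteq> Cn V \<Sigma>"
  using assms unfolding monotonic_def by blast

lemma Cn_eq_carrier_superset:
  assumes "is_logic L V" and "monotonic L V"
    and "Cn V \<Gamma> = L" and "\<Gamma> \<subseteq> \<Sigma>" and "\<Sigma> \<subseteq> L"
  shows "Cn V \<Sigma> = L"
proof
  show "Cn V \<Sigma> \<subseteq> L"
    using assms(1) by (rule Cn_subset_carrier)
  show "L \<subseteq> Cn V \<Sigma>"
    using Cn_mono[OF assms(2,4,5)] assms(3) by simp
qed

lemma finite_subset_extends_to_finite_trivial:
  assumes "is_logic L V" and "monotonic L V" and "finitely_trivializable L V"
    and "finite \<Delta>" and "\<Delta> \<subseteq> L"
  obtains \<Sigma> where "finite \<Sigma>" and "\<Delta> \<subseteq> \<Sigma>" and "\<Sigma> \<subseteq> L" and "Cn V \<Sigma> = L"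
proof -
  obtain \<Gamma> where \<Gamma>: "\<Gamma> \<subseteq> L" "finite \<Gamma>" "Cn V \<Gamma> = L"
    using assms(3) unfolding finitely_trivializable_def by blast
  show thesis
  proof
    show "finite (\<Delta> \<union> \<Gamma>)"
      using \<open>finite \<Delta>\<close> \<open>finite \<Gamma>\<close> by simp
    show "\<Delta> \<subseteq> \<Delta> \<union> \<Gamma>"
      by simp
    show "\<Delta> \<union> \<Gamma> \<subseteq> L"
      using \<open>\<Delta> \<subseteq> L\<close> \<open>\<Gamma> \<subseteq> L\<close> by simp
    then show "Cn V (\<Delta> \<union> \<Gamma>) = L"
      using Cn_eq_carrier_superset[OF assms(1,2) \<Gamma>(3)] by simp
  qed
qed

theorem theorem3p29:
  fixes L :: "'a set" and V :: "('a set \<times> 'a) set"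
  assumes "is_logic L V"
    and "monotonic L V"
    and "infinite L"
    and "finitely_trivializable L V"
  shows "sECQ L V"
  unfolding sECQ_def
proof
  fix \<alpha> assume "\<alpha> \<in> L"
  then obtain \<Sigma> where "finite \<Sigma>" "{\<alpha>} \<subseteq> \<Sigma>" "\<Sigma> \<subseteq> L" "Cn V \<Sigma> = L"
    using finite_subset_extends_to_finite_trivial[OF assms(1,2,4), of "{\<alpha>}"] by blast
  moreover have "\<Sigma> \<noteq> L"
    using \<open>finite \<Sigma>\<close> \<open>infinite L\<close> by blast
  ultimately show "\<exists>\<Gamma>. \<Gamma> \<subset> L \<and> \<alpha> \<in> \<Gamma> \<and> Cn V \<Gamma> = L"
    by blast
qed

end
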